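(* Let $D$ be a knot projection. A partial Kauffman state $x$ on $\Gamma(D)$ induces a discrete Morse function on $\Xi(D)$ if and only if $x$ does not support a monochromatic loop.
   Context: Setting. $D$ is the projection of a knot diagram with at least one crossing, viewed as a connected 4-valent graph on $S^2$, with a chequerboard black/white colouring of the regions of $S^2\setminus D$. The black graph $G_b$ has the black regions as vertices and one edge for each crossing, joining the two black regions opposite each other at that crossing; the white graph $G_w$ is defined analogously and is the plane dual of $G_b$. The overlaid Tait graph $\Gamma(D)$ is the superimposition of $G_b$ and $G_w$ on $S^2$: its vertices are the black regions, the white regions and the crossings, and its edges are the half-edges of $G_b$ and $G_w$, each joining a region to an incident crossing. A partial Kauffman state is an injection from a subset of the crossings of $D$ to the set of regions $V(G_w)\sqcup V(G_b)$, pairing each crossing in the subset with exactly one of its four adjacent regions; equivalently, it is a matching on $\Gamma(D)$. $\Xi(D)$ is the cell structure on $S^2$ whose 2-cells are given by the vertices of $G_w$, 1-cells by the crossings of $D$, and 0-cells by the vertices of $G_b$ (its 1-skeleton is $G_b$). Its poset graph is $\Gamma(D)$, with edges oriented from white vertices to crossings and from crossings to black vertices. A discrete Morse function on $\Xi(D)$ means an equivalence class of such functions, i.e. an acyclic partial matching: a matching on $\Gamma(D)$ such that reversing the orientation of all matched edges yields a directed graph without directed cycles. A partial Kauffman state induces a discrete Morse function if the corresponding matching is acyclic. A simple loop in $\Gamma(D)$ is monochromatic if its vertices consist only of crossings and black regions, or only of crossings and white regions. A matching $x$ supports the monochromatic loop $\gamma$ if the edges of $\gamma$ belong alternately to $x$.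 *)

theory Defs
  imports "HOL-Analysis.Analysis" "Graph_Theory.Arc_Walk"
begin

section \<open>Matchings and loops in multigraphs\<close>

text \<open>
  An undirected multigraph is represented by a \<^typ>\<open>('v, 'e) pre_digraph\<close> whose arc
  orientations are ignored. Parallel edges are allowed.
\<close>

definition ends :: "('v, 'e) pre_digraph \<Rightarrow> 'e \<Rightarrow> 'v set" where
  "ends G e = {tail G e, head G e}"

definition matching :: "('v, 'e) pre_digraph \<Rightarrow> 'e set \<Rightarrow> bool" where
  "matching G M \<longleftrightarrow>
     M \<subseteq> arcs G \<and> (\<forall>e\<in>M. \<forall>e'\<in>M. e \<noteq> e' \<longrightarrow> ends G e \<inter> ends G e' = {})"

text \<open>
  A simple loop with cyclically ordered vertices \<open>vs\<close> and edges \<open>es\<close>, the \<open>i\<close>-th edge joining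
  the \<open>i\<close>-th vertex to the next one. Two distinct parallel edges form a loop of length 2.
\<close>

definition simple_loop :: "('v, 'e) pre_digraph \<Rightarrow> 'v list \<Rightarrow> 'e list \<Rightarrow> bool" where
  "simple_loop G vs es \<longleftrightarrow>
     length es = length vs \<and> 2 \<le> length vs \<and> distinct vs \<and> distinct es \<and>
     set vs \<subseteq> verts G \<and> set es \<subseteq> arcs G \<and>
     (\<forall>i<length vs. ends G (es ! i) = {vs ! i, vs ! (Suc i mod length vs)})"

definition alternating :: "'e set \<Rightarrow> 'e list \<Rightarrow> bool" where
  "alternating M es \<longleftrightarrow>
     (\<forall>i<length es. es ! i \<in> M \<longleftrightarrow> es ! (Suc i mod length es) \<notin> M)"

definition reverse_arcs :: "('v, 'e) pre_digraph \<Rightarrow> 'e set \<Rightarrow> ('v, 'e) pre_digraph" where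
  "reverse_arcs G M =
     G\<lparr>tail := \<lambda>e. if e \<in> M then head G e else tail G e,
       head := \<lambda>e. if e \<in> M then tail G e else head G e\<rparr>"

definition acyclic_matching :: "('v, 'e) pre_digraph \<Rightarrow> 'e set \<Rightarrow> bool" where
  "acyclic_matching G M \<longleftrightarrow>
     matching G M \<and> (\<nexists>p. pre_digraph.cycle (reverse_arcs G M) p)"


section \<open>Knot projections\<close>

type_synonym R3 = "real ^ 3"

abbreviation S2 :: "R3 set" where
  "S2 \<equiv> sphere 0 1"

abbreviation velocity :: "(real \<Rightarrow> R3) \<Rightarrow> real \<Rightarrow> R3" where
  "velocity \<gamma> t \<equiv> vector_derivative \<gamma> (at t)"

definition crossings :: "(real \<Rightarrow> R3) \<Rightarrow> R3 set" where
  "crossings \<gamma> = {\<gamma> s |s t. s \<in> {0..<1} \<and> t \<in> {0..<1} \<and> s \<noteq> t \<and> \<gamma> s = \<gamma> t}"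

text \<open>
  A knot projection is a generic immersion of the circle in the sphere, given as a function of
  period 1: its only singularities are finitely many transverse double points.
\<close>

definition knot_projection :: "(real \<Rightarrow> R3) \<Rightarrow> bool" where
  "knot_projection \<gamma> \<longleftrightarrow>
     (\<forall>t. \<gamma> (t + 1) = \<gamma> t) \<and>
     range \<gamma> \<subseteq> S2 \<and>
     \<gamma> C1_differentiable_on UNIV \<and>
     (\<forall>t. velocity \<gamma> t \<noteq> 0) \<and>
     finite (crossings \<gamma>) \<and>
     (\<forall>p\<in>crossings \<gamma>. card {t \<in> {0..<1}. \<gamma> t = p} = 2) \<and>
     (\<forall>s\<in>{0..<1}. \<forall>t\<in>{0..<1}. s \<noteq> t \<and> \<gamma> s = \<gamma> t \<longrightarrow> velocity \<gamma> s \<notin> span {velocity \<gamma> t})"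

definition regions :: "(real \<Rightarrow> R3) \<Rightarrow> R3 set set" where
  "regions \<gamma> = components (S2 - range \<gamma>)"

text \<open>
  A chequerboard colouring is given by its set of black regions; the other regions are white.
  The components of \<open>range \<gamma> - crossings \<gamma>\<close> are the (open) edges of the 4-valent graph.
\<close>

definition chequerboard :: "(real \<Rightarrow> R3) \<Rightarrow> R3 set set \<Rightarrow> bool" where
  "chequerboard \<gamma> B \<longleftrightarrow>
     B \<subseteq> regions \<gamma> \<and>
     (\<forall>e\<in>components (range \<gamma> - crossings \<gamma>). \<forall>R\<in>regions \<gamma>. \<forall>R'\<in>regions \<gamma>.
        R \<noteq> R' \<and> e \<subseteq> closure R \<and> e \<subseteq> closure R' \<longrightarrow> (R \<in> B \<longleftrightarrow> R' \<notin> B))"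


section \<open>The overlaid Tait graph\<close>

text \<open>
  The four corners at a crossing \<open>c\<close> are the sectors cut out by the tangent lines of the two
  strands. The sector between the tangent vectors \<open>a\<close> and \<open>b\<close> is labelled by its direction
  \<open>a + b\<close>, so opposite corners have opposite directions.
\<close>

definition corner_directions :: "(real \<Rightarrow> R3) \<Rightarrow> R3 \<Rightarrow> R3 set" where
  "corner_directions \<gamma> c =
     {\<delta> *\<^sub>R velocity \<gamma> s + \<epsilon> *\<^sub>R velocity \<gamma> t |s t \<delta> \<epsilon>.
        s \<in> {0..<1} \<and> t \<in> {0..<1} \<and> s \<noteq> t \<and> \<gamma> s = c \<and> \<gamma> t = c \<and>
        \<delta> \<in> {- 1, 1} \<and> \<epsilon> \<in> {- 1, 1}}"

text \<open>
  An edge of the overlaid Tait graph is half of an edge of the black or of the white graph: it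
  leaves a crossing through one of its four corners and ends in the region that fills this corner.
  The direction is part of the edge because at a nugatory crossing two opposite corners lie in
  the same region, which gives two parallel edges.
\<close>

datatype half_edge = Half_Edge (crossing_of: R3) (direction_of: R3) (region_of: "R3 set")

definition half_edges :: "(real \<Rightarrow> R3) \<Rightarrow> half_edge set" where
  "half_edges \<gamma> =
     {Half_Edge c v R |c v R.
        c \<in> crossings \<gamma> \<and> v \<in> corner_directions \<gamma> c \<and> R \<in> regions \<gamma> \<and>
        (\<forall>\<^sub>F r in at_right 0. sgn (c + r *\<^sub>R v) \<in> R)}"

datatype tait_vertex = Crossing R3 | Region "R3 set"

text \<open>
  The cell structure \<open>\<Xi>(D)\<close> has the white regions as 2-cells, the crossings as 1-cells and the
  black regions as 0-cells. Its poset graph is the overlaid Tait graph \<open>\<Gamma>(D)\<close> with all edges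
  oriented towards the cell of smaller dimension.
\<close>

definition cell_dim :: "R3 set set \<Rightarrow> tait_vertex \<Rightarrow> nat" where
  "cell_dim B u = (case u of Crossing c \<Rightarrow> 1 | Region R \<Rightarrow> if R \<in> B then 0 else 2)"

definition tait_graph ::
  "(real \<Rightarrow> R3) \<Rightarrow> R3 set set \<Rightarrow> (tait_vertex, half_edge) pre_digraph" where
  "tait_graph \<gamma> B =
     \<lparr>verts = Crossing ` crossings \<gamma> \<union> Region ` regions \<gamma>,
      arcs = half_edges \<gamma>,
      tail = \<lambda>e. if cell_dim B (Crossing (crossing_of e)) < cell_dim B (Region (region_of e))
        then Region (region_of e) else Crossing (crossing_of e),
      head = \<lambda>e. if cell_dim B (Crossing (crossing_of e)) < cell_dim B (Region (region_of e))
        then Crossing (crossing_of e) else Region (region_of e)\<rparr>"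

definition discrete_Morse_function ::
  "(real \<Rightarrow> R3) \<Rightarrow> R3 set set \<Rightarrow> half_edge set \<Rightarrow> bool" where
  "discrete_Morse_function \<gamma> B M \<longleftrightarrow> acyclic_matching (tait_graph \<gamma> B) M"

definition monochromatic_loop ::
  "(real \<Rightarrow> R3) \<Rightarrow> R3 set set \<Rightarrow> tait_vertex list \<Rightarrow> half_edge list \<Rightarrow> bool" where
  "monochromatic_loop \<gamma> B vs es \<longleftrightarrow>
     simple_loop (tait_graph \<gamma> B) vs es \<and>
     (set vs \<subseteq> Crossing ` crossings \<gamma> \<union> Region ` B \<or>
      set vs \<subseteq> Crossing ` crossings \<gamma> \<union> Region ` (regions \<gamma> - B))"


section \<open>Partial Kauffman states\<close>

text \<open>
  A partial Kauffman state assigns to each crossing in its domain the half-edge leading to one of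
  the four adjacent regions; distinct crossings are assigned distinct regions.
\<close>

definition partial_Kauffman_state ::
  "(real \<Rightarrow> R3) \<Rightarrow> (R3 \<rightharpoonup> half_edge) \<Rightarrow> bool" where
  "partial_Kauffman_state \<gamma> x \<longleftrightarrow>
     dom x \<subseteq> crossings \<gamma> \<and>
     (\<forall>c\<in>dom x. the (x c) \<in> half_edges \<gamma> \<and> crossing_of (the (x c)) = c) \<and>
     inj_on (\<lambda>c. region_of (the (x c))) (dom x)"

definition matching_of :: "(R3 \<rightharpoonup> half_edge) \<Rightarrow> half_edge set" where
  "matching_of x = ran x"

definition induces_discrete_Morse_function ::
  "(real \<Rightarrow> R3) \<Rightarrow> R3 set set \<Rightarrow> (R3 \<rightharpoonup> half_edge) \<Rightarrow> bool" where
  "induces_discrete_Morse_function \<gamma> B x \<longleftrightarrow> discrete_Morse_function \<gamma> B (matching_of x)"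

definition supports_loop :: "(R3 \<rightharpoonup> half_edge) \<Rightarrow> half_edge list \<Rightarrow> bool" where
  "supports_loop x es \<longleftrightarrow> alternating (matching_of x) es"

lemma ends_tait_graph:
  "ends (tait_graph \<gamma> B) e = {Crossing (crossing_of e), Region (region_of e)}"
  by (auto simp: ends_def tait_graph_def)

text \<open>Partial Kauffman states are the same as matchings on the overlaid Tait graph.\<close>

lemma matching_iff_partial_Kauffman_state:
  "matching (tait_graph \<gamma> B) M \<longleftrightarrow> (\<exists>x. partial_Kauffman_state \<gamma> x \<and> matching_of x = M)"
proof
  assume "matching (tait_graph \<gamma> B) M"
  then have M: "M \<subseteq> half_edges \<gamma>"
    and dis: "\<And>e e'. e \<in> M \<Longrightarrow> e' \<in> M \<Longrightarrow>
      crossing_of e = crossing_of e' \<or> region_of e = region_of e' \<Longrightarrow> e = e'"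
    by (auto simp: matching_def ends_tait_graph) (auto simp: tait_graph_def)
  define x where "x c = (if \<exists>e\<in>M. crossing_of e = c
    then Some (THE e. e \<in> M \<and> crossing_of e = c) else None)" for c
  have x: "x c = Some e \<longleftrightarrow> e \<in> M \<and> crossing_of e = c" for c e
  proof (cases "\<exists>e\<in>M. crossing_of e = c")
    case True
    then obtain e' where e': "e' \<in> M" "crossing_of e' = c" by blast
    then have "(THE e. e \<in> M \<and> crossing_of e = c) = e'" using dis by blast
    then show ?thesis using e' dis True by (auto simp: x_def)
  qed (auto simp: x_def)
  have "partial_Kauffman_state \<gamma> x"
    unfolding partial_Kauffman_state_def
  proof (intro conjI ballI inj_onI subsetI)
    fix c assume "c \<in> dom x"
    then obtain e where e: "x c = Some e" by blast
    then have "e \<in> half_edges \<gamma>" "crossing_of e = c" using M x by blast+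
    then show "c \<in> crossings \<gamma>" "the (x c) \<in> half_edges \<gamma>" "crossing_of (the (x c)) = c"
      using e by (auto simp: half_edges_def)
  next
    fix c d assume "c \<in> dom x" "d \<in> dom x" and R: "region_of (the (x c)) = region_of (the (x d))"
    then obtain e e' where e: "x c = Some e" "x d = Some e'" by blast
    then have "region_of e = region_of e'" using R by simp
    then have "e = e'" using e x dis by blast
    then show "c = d" using e x by auto
  qed
  moreover have "matching_of x = M"
    using x by (auto simp: matching_of_def ran_def)
  ultimately show "\<exists>x. partial_Kauffman_state \<gamma> x \<and> matching_of x = M" by blast
next
  assume "\<exists>x. partial_Kauffman_state \<gamma> x \<and> matching_of x = M"
  then obtain x where x: "partial_Kauffman_state \<gamma> x" and M: "M = ran x"
    by (auto simp: matching_of_def)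
  have *: "e \<in> half_edges \<gamma> \<and> crossing_of e = c" if "x c = Some e" for c e
  proof -
    have "c \<in> dom x" using that by blast
    then have "the (x c) \<in> half_edges \<gamma> \<and> crossing_of (the (x c)) = c"
      using x unfolding partial_Kauffman_state_def by blast
    then show ?thesis using that by simp
  qed
  have inj: "c = c'" if "x c = Some e" "x c' = Some e'" "region_of e = region_of e'" for c c' e e'
  proof -
    have "c \<in> dom x" "c' \<in> dom x" using that by blast+
    moreover have "inj_on (\<lambda>c. region_of (the (x c))) (dom x)"
      using x by (simp add: partial_Kauffman_state_def)
    moreover have "region_of (the (x c)) = region_of (the (x c'))" using that by simp
    ultimately show ?thesis by (blast dest: inj_onD)
  qed
  have "e = e'" if eM: "e \<in> M" "e' \<in> M"
    and share: "crossing_of e = crossing_of e' \<or> region_of e = region_of e'" for e e'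
  proof -
    obtain c c' where c: "x c = Some e" "x c' = Some e'"
      using eM unfolding M ran_def by blast
    then have "c = c'" using share * inj by blast
    then show ?thesis using c by simp
  qed
  moreover have "M \<subseteq> arcs (tait_graph \<gamma> B)"
    using * by (auto simp: tait_graph_def M ran_def)
  ultimately show "matching (tait_graph \<gamma> B) M"
    by (auto simp: matching_def ends_tait_graph)
qed

end

theory Submission
  imports Defs
begin

text \<open>
  After reversal of the matched edges, an edge at a black region points towards the crossing iff it
  is matched, and an edge at a white region iff it is unmatched. The step from a black to a white
  edge on a directed path happens at a crossing and uses two matched edges, so it does not exist:
  directed cycles are monochromatic. Conversely, the edges of a monochromatic loop that alternate
  in the matching alternately point towards and away from crossings; as the vertices of the loop
  alternate too, the loop is coherently oriented.
\<close>

section \<open>Cyclic lists\<close>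

text \<open>Stepping round a cycle from any start reaches every index, so a property preserved by
  the cyclic successor spreads from one place to all.\<close>

lemma cyclic_induct:
  fixes i j n :: nat
  assumes step: "\<And>i. i < n \<Longrightarrow> P i \<Longrightarrow> P (Suc i mod n)"
    and "j < n" "P j" "i < n"
  shows "P i"
proof -
  have "P ((j + k) mod n)" for k
  proof (induction k)
    case 0
    then show ?case using assms by simp
  next
    case (Suc k)
    have "(j + k) mod n < n" using \<open>j < n\<close> by simp
    from step[OF this Suc] show ?case by (simp add: mod_Suc_eq)
  qed
  \<comment> \<open>Since \<open>j < n\<close>, this many steps from \<open>j\<close> lead to
    \<open>n + i\<close>, which is \<open>i\<close> modulo \<open>n\<close>.\<close>
  from this[of "n - j + i"] show ?thesis using assms by simp
qed

lemma rotate1_rev_rotate1: "rotate1 (rev (rotate1 xs)) = rev xs"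
  by (cases xs) simp_all

lemma alternating_cong:
  assumes "\<And>e. e \<in> set es \<Longrightarrow> e \<in> M \<longleftrightarrow> e \<in> N"
  shows "alternating M es \<longleftrightarrow> alternating N es"
proof -
  have "es ! (Suc i mod length es) \<in> set es" if "i < length es" for i
    by (rule nth_mem, rule mod_less_divisor) (use that in linarith)
  then show ?thesis using assms by (simp add: alternating_def)
qed

lemma alternating_Compl: "alternating (- M) es \<longleftrightarrow> alternating M es"
  by (auto simp: alternating_def)

section \<open>Directed cycles and simple loops\<close>

text \<open>Both sides of the equation list the vertices visited by the walk, read off once from the
  tails and once from the heads.\<close>

lemma cas_iff_map:
  "pre_digraph.cas G u p v \<longleftrightarrow> map (tail G) p @ [v] = u # map (head G) p"
proof (induction p arbitrary: u)
  case (Cons e p)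
  then show ?case by (auto simp: pre_digraph.cas.simps)
qed (auto simp: pre_digraph.cas.simps)

text \<open>For a closed walk, \<open>cas_iff_map\<close> makes the heads a cyclic shift of the
  tails. The visited vertices after the first are the heads, so distinctness passes between heads
  and tails. This form allows access by index modulo the length.\<close>

lemma (in wf_digraph) cycle_iff_rotate1:
  "cycle p \<longleftrightarrow> p \<noteq> [] \<and> set p \<subseteq> arcs G \<and> distinct (map (tail G) p) \<and>
     map (head G) p = rotate1 (map (tail G) p)"
proof
  assume "cycle p"
  then obtain u where u: "set p \<subseteq> arcs G" "cas u p u" "p \<noteq> []"
    "distinct (tl (awalk_verts u p))"
    by (auto simp: cycle_def awalk_def)
  have heads: "map (head G) p = rotate1 (map (tail G) p)"
    using u(2,3) by (cases p) (auto simp: cas_iff_map)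
  have "distinct (map (head G) p)"
    using u(3,4) by (simp add: awalk_verts_conv'[OF u(2)])
  then have "distinct (map (tail G) p)" unfolding heads by simp
  then show "p \<noteq> [] \<and> set p \<subseteq> arcs G \<and> distinct (map (tail G) p) \<and>
      map (head G) p = rotate1 (map (tail G) p)"
    using u heads by blast
next
  assume p: "p \<noteq> [] \<and> set p \<subseteq> arcs G \<and> distinct (map (tail G) p) \<and>
    map (head G) p = rotate1 (map (tail G) p)"
  define u where "u = tail G (hd p)"
  have cas: "cas u p u"
    using p by (cases p) (auto simp: cas_iff_map u_def)
  have "distinct (map (head G) p)"
    using p by (metis distinct1_rotate)
  moreover have "u \<in> verts G" using p by (cases p) (auto simp: u_def)
  ultimately show "cycle p"
    using p cas by (auto simp: cycle_def awalk_def awalk_verts_conv'[OF cas])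
qed

context wf_digraph
begin

context
  fixes P :: "'a \<Rightarrow> bool"
  assumes bipartite: "\<And>e. e \<in> arcs G \<Longrightarrow> P (tail G e) \<longleftrightarrow> \<not> P (head G e)"
begin

text \<open>Bipartiteness excludes an arc from a vertex to itself, hence a cycle of length 1.
  Distinct tails force distinct arcs.\<close>

lemma simple_loop_if_cycle:
  assumes "cycle p"
  shows "simple_loop G (map (tail G) p) p"
proof -
  have p: "p \<noteq> []" "set p \<subseteq> arcs G" "distinct (map (tail G) p)"
    and heads: "map (head G) p = rotate1 (map (tail G) p)"
    using assms by (auto simp: cycle_iff_rotate1)
  have "length p \<noteq> 1"
  proof
    assume "length p = 1"
    then obtain e where "p = [e]" by (auto simp: length_Suc_conv)
    then show False using heads p(2) bipartite[of e] by auto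
  qed
  then have "2 \<le> length p" using p(1) by (cases p rule: remdups_adj.cases) auto
  moreover have "ends G (p ! i) = {map (tail G) p ! i, map (tail G) p ! (Suc i mod length p)}"
    if "i < length p" for i
  proof -
    have "head G (p ! i) = map (head G) p ! i" using that by simp
    then show ?thesis unfolding heads using that by (simp add: ends_def nth_rotate1)
  qed
  ultimately show ?thesis
    using p by (auto simp: simple_loop_def distinct_map)
qed

lemma alternating_if_cycle:
  assumes "cycle p"
  shows "alternating {e. P (tail G e)} p"
proof -
  have p: "set p \<subseteq> arcs G" and heads: "map (head G) p = rotate1 (map (tail G) p)"
    using assms by (auto simp: cycle_iff_rotate1)
  have "P (tail G (p ! i)) \<longleftrightarrow> \<not> P (tail G (p ! (Suc i mod length p)))" if "i < length p" for i
  proof -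
    have "head G (p ! i) = map (head G) p ! i" using that by simp
    also have "\<dots> = tail G (p ! (Suc i mod length p))"
      unfolding heads using that by (cases "p = []") (simp_all add: nth_rotate1)
    finally show ?thesis using bipartite[of "p ! i"] p nth_mem[OF that] by auto
  qed
  then show ?thesis by (simp add: alternating_def)
qed

text \<open>Each edge points forward or backward along the loop. Alternation makes all of them agree
  with the first, so \<open>es\<close> or its reversal is a directed cycle.\<close>

lemma ex_cycle_if_alternating_simple_loop:
  assumes loop: "simple_loop G vs es" and alt: "alternating {e. P (tail G e)} es"
  shows "\<exists>p. cycle p"
proof -
  let ?n = "length vs"
  have len: "length es = ?n" "0 < ?n" and es: "set es \<subseteq> arcs G" and dist: "distinct vs"
    and ends: "\<And>i. i < ?n \<Longrightarrow> ends G (es ! i) = {vs ! i, vs ! (Suc i mod ?n)}"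
    using loop by (auto simp: simple_loop_def)
  define fwd where "fwd i \<longleftrightarrow> tail G (es ! i) = vs ! i \<and> head G (es ! i) = vs ! (Suc i mod ?n)" for i
  define bwd where "bwd i \<longleftrightarrow> head G (es ! i) = vs ! i \<and> tail G (es ! i) = vs ! (Suc i mod ?n)" for i
  have cases: "fwd i \<or> bwd i" if "i < ?n" for i
    using ends[OF that] by (auto simp: fwd_def bwd_def ends_def doubleton_eq_iff)
  have next_less: "Suc i mod ?n < ?n" for i
    using len by simp
  have arc: "es ! i \<in> arcs G" if "i < ?n" for i
    using es len that by auto
  have alternate: "P (tail G (es ! i)) \<longleftrightarrow> P (head G (es ! (Suc i mod ?n)))" if "i < ?n" for i
  proof -
    have "P (tail G (es ! i)) \<longleftrightarrow> \<not> P (tail G (es ! (Suc i mod ?n)))"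
      using alt that unfolding alternating_def len(1) by blast
    then show ?thesis using bipartite[OF arc[OF next_less[of i]]] by blast
  qed
  have fwd_step: "fwd (Suc i mod ?n)" if "i < ?n" "fwd i" for i
  proof (rule ccontr)
    assume "\<not> fwd (Suc i mod ?n)"
    then have "bwd (Suc i mod ?n)" using cases next_less by blast
    \<comment> \<open>Edges \<open>i\<close> and \<open>Suc i mod ?n\<close> would share their head,
      so by \<open>alternate\<close> the tail and head of edge \<open>i\<close> would lie in the
      same class. For \<open>bwd_step\<close> the shared vertex is the common tail.\<close>
    then show False
      using that alternate[of i] bipartite[OF arc[of i]] by (simp add: fwd_def bwd_def)
  qed
  have bwd_step: "bwd (Suc i mod ?n)" if "i < ?n" "bwd i" for i
  proof (rule ccontr)
    assume "\<not> bwd (Suc i mod ?n)"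
    then have "fwd (Suc i mod ?n)" using cases next_less by blast
    then show False
      using that alternate[of i] bipartite[OF arc[OF next_less[of i]]]
      by (simp add: fwd_def bwd_def)
  qed
  from cases[OF len(2)] show ?thesis
  proof
    assume "fwd 0"
    then have "fwd i" if "i < ?n" for i
      using cyclic_induct[of ?n fwd] fwd_step len(2) that by blast
    then have "map (tail G) es = vs" "map (head G) es = rotate1 vs"
      using len by (auto intro!: nth_equalityI simp: fwd_def nth_rotate1)
    then have "cycle es"
      using len es dist by (auto simp: cycle_iff_rotate1)
    then show ?thesis ..
  next
    assume "bwd 0"
    then have "bwd i" if "i < ?n" for i
      using cyclic_induct[of ?n bwd] bwd_step len(2) that by blast
    then have "map (head G) es = vs" "map (tail G) es = rotate1 vs"
      using len by (auto intro!: nth_equalityI simp: bwd_def nth_rotate1)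
    then have "map (head G) (rev es) = rev vs" "map (tail G) (rev es) = rev (rotate1 vs)"
      by (simp_all flip: rev_map)
    \<comment> \<open>The tails of \<open>rev es\<close> are \<open>rev (rotate1 vs)\<close>;
      rotating them gives \<open>rev vs\<close>, the list of heads.\<close>
    then have "cycle (rev es)"
      using len es dist by (auto simp: cycle_iff_rotate1 rotate1_rev_rotate1)
    then show ?thesis ..
  qed
qed

end

end

section \<open>The overlaid Tait graph with reversed matched edges\<close>

lemma simple_loop_reverse_arcs: "simple_loop (reverse_arcs G M) vs es \<longleftrightarrow> simple_loop G vs es"
proof -
  have "ends (reverse_arcs G M) = ends G"
    by (rule ext) (auto simp: ends_def reverse_arcs_def)
  then show ?thesis by (simp add: simple_loop_def) (simp add: reverse_arcs_def)
qed

lemma wf_digraph_reverse_arcs: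
  assumes "wf_digraph G"
  shows "wf_digraph (reverse_arcs G M)"
  using assms by (auto simp: wf_digraph_def reverse_arcs_def)

lemma wf_digraph_tait_graph: "wf_digraph (tait_graph \<gamma> B)"
  by unfold_locales (auto simp: tait_graph_def half_edges_def)

lemma tail_reverse_tait_graph:
  "tail (reverse_arcs (tait_graph \<gamma> B) M) e =
    (if region_of e \<in> B \<longleftrightarrow> e \<in> M then Region (region_of e) else Crossing (crossing_of e))"
  by (auto simp: reverse_arcs_def tait_graph_def cell_dim_def)

lemma head_reverse_tait_graph:
  "head (reverse_arcs (tait_graph \<gamma> B) M) e =
    (if region_of e \<in> B \<longleftrightarrow> e \<in> M then Crossing (crossing_of e) else Region (region_of e))"
  by (auto simp: reverse_arcs_def tait_graph_def cell_dim_def)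

lemma black_step:
  assumes M: "matching (tait_graph \<gamma> B) M"
    and consecutive: "head (reverse_arcs (tait_graph \<gamma> B) M) e = tail (reverse_arcs (tait_graph \<gamma> B) M) e'"
    and black: "region_of e \<in> B"
  shows "region_of e' \<in> B"
proof (rule ccontr)
  assume white: "region_of e' \<notin> B"
  \<comment> \<open>A shared region would have both colours, so the shared vertex is a crossing.
    Entering it from black and leaving it towards white both require reversed edges.\<close>
  then have "e \<in> M" "e' \<in> M" "crossing_of e = crossing_of e'"
    using consecutive black
    by (auto simp: head_reverse_tait_graph tail_reverse_tait_graph split: if_splits)
  then have "e = e'"
    using M by (auto simp: matching_def ends_tait_graph)
  then show False using black white by simp
qed

text \<open>A single step from white to black is possible, through two unmatched edges. On a cycle
  it cannot occur either: by \<open>black_step\<close>, one black edge makes all later edges black,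
  and these are all edges of the cycle.\<close>

lemma cycle_reverse_tait_graph_monochromatic:
  assumes M: "matching (tait_graph \<gamma> B) M"
    and cyc: "pre_digraph.cycle (reverse_arcs (tait_graph \<gamma> B) M) p"
  shows "region_of ` set p \<subseteq> B \<or> region_of ` set p \<inter> B = {}"
proof (rule disjCI)
  let ?R = "reverse_arcs (tait_graph \<gamma> B) M"
  interpret wf_digraph ?R
    by (intro wf_digraph_reverse_arcs wf_digraph_tait_graph)
  assume "\<not> region_of ` set p \<inter> B = {}"
  then obtain j where j: "j < length p" "region_of (p ! j) \<in> B"
    by (auto simp: in_set_conv_nth)
  have "region_of (p ! (Suc i mod length p)) \<in> B"
    if "i < length p" "region_of (p ! i) \<in> B" for i
  proof (rule black_step[OF M _ that(2)])
    have "map (head ?R) p ! i = rotate1 (map (tail ?R) p) ! i"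
      using cyc by (simp add: cycle_iff_rotate1)
    moreover have "Suc i mod length p < length p"
      using that(1) by (intro mod_less_divisor) linarith
    ultimately show "head ?R (p ! i) = tail ?R (p ! (Suc i mod length p))"
      using that by (simp add: nth_rotate1)
  qed
  then have "region_of (p ! i) \<in> B" if "i < length p" for i
    using cyclic_induct[of "length p" "\<lambda>i. region_of (p ! i) \<in> B"] j that by blast
  then show "region_of ` set p \<subseteq> B"
    by (auto simp: in_set_conv_nth)
qed

lemma simple_loop_set_vertices:
  assumes "simple_loop G vs es"
  shows "set vs = (\<Union>e\<in>set es. ends G e)"
proof -
  have len: "length es = length vs" "0 < length vs"
    and ends: "\<And>i. i < length vs \<Longrightarrow> ends G (es ! i) = {vs ! i, vs ! (Suc i mod length vs)}"
    using assms by (auto simp: simple_loop_def)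
  have "vs ! (Suc i mod length vs) \<in> set vs" for i
    using len by (intro nth_mem mod_less_divisor)
  then have "ends G e \<subseteq> set vs" if "e \<in> set es" for e
    using that ends len by (auto simp: in_set_conv_nth)
  moreover have "v \<in> (\<Union>e\<in>set es. ends G e)" if "v \<in> set vs" for v
    using that ends len by (metis UN_I in_set_conv_nth insertI1)
  ultimately show ?thesis by blast
qed

text \<open>Every edge has exactly one region as an end, so the colour condition on vertices can be
  read off the edges, where \<open>tail_reverse_tait_graph\<close> applies.\<close>

lemma monochromatic_loop_iff:
  "monochromatic_loop \<gamma> B vs es \<longleftrightarrow> simple_loop (tait_graph \<gamma> B) vs es \<and>
    (region_of ` set es \<subseteq> B \<or> region_of ` set es \<inter> B = {})"
proof (cases "simple_loop (tait_graph \<gamma> B) vs es")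
  case True
  then have "set es \<subseteq> half_edges \<gamma>"
    by (simp add: simple_loop_def tait_graph_def)
  then have crossings: "crossing_of ` set es \<subseteq> crossings \<gamma>"
    and regions: "region_of ` set es \<subseteq> regions \<gamma>"
    by (auto simp: half_edges_def)
  have "set vs = Crossing ` crossing_of ` set es \<union> Region ` region_of ` set es"
    unfolding simple_loop_set_vertices[OF True] ends_tait_graph by blast
  \<comment> \<open>Kept general in \<open>A\<close> to serve both colours: \<open>A\<close> is
    \<open>B\<close> or \<open>regions \<gamma> - B\<close>.\<close>
  then have "set vs \<subseteq> Crossing ` crossings \<gamma> \<union> Region ` A \<longleftrightarrow> region_of ` set es \<subseteq> A" for A
    using crossings by (simp add: image_subset_iff) blast
  moreover have "region_of ` set es \<subseteq> regions \<gamma> - B \<longleftrightarrow> region_of ` set es \<inter> B = {}"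
    using regions by blast
  ultimately show ?thesis
    using True by (simp add: monochromatic_loop_def)
qed (simp add: monochromatic_loop_def)

text \<open>An edge leaves its crossing iff it is matched (at white regions) or unmatched (at black
  regions). On edges of one colour this is membership in \<open>M\<close> or in its complement, and
  alternation does not distinguish the two.\<close>

lemma alternating_crossing_tail_iff:
  assumes "region_of ` set es \<subseteq> B \<or> region_of ` set es \<inter> B = {}"
  shows "alternating {e. tail (reverse_arcs (tait_graph \<gamma> B) M) e \<in> range Crossing} es \<longleftrightarrow>
    alternating M es"
  using assms
proof
  assume "region_of ` set es \<subseteq> B"
  then have "alternating {e. tail (reverse_arcs (tait_graph \<gamma> B) M) e \<in> range Crossing} es \<longleftrightarrow>
      alternating (- M) es"
    by (intro alternating_cong) (auto simp: tail_reverse_tait_graph)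
  then show ?thesis by (simp add: alternating_Compl)
next
  assume "region_of ` set es \<inter> B = {}"
  then show ?thesis
    by (intro alternating_cong) (auto simp: tail_reverse_tait_graph)
qed

theorem theorem4p3:
  fixes \<gamma> :: "real \<Rightarrow> real ^ 3"
    and B :: "(real ^ 3) set set"
    and x :: "real ^ 3 \<rightharpoonup> half_edge"
  assumes "knot_projection \<gamma>"
    and "crossings \<gamma> \<noteq> {}"
    and "chequerboard \<gamma> B"
    and "partial_Kauffman_state \<gamma> x"
  shows "induces_discrete_Morse_function \<gamma> B x \<longleftrightarrow>
    (\<nexists>vs es. monochromatic_loop \<gamma> B vs es \<and> supports_loop x es)"
proof -
  let ?M = "matching_of x"
  let ?R = "reverse_arcs (tait_graph \<gamma> B) ?M"
  have M: "matching (tait_graph \<gamma> B) ?M"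
    using assms(4) matching_iff_partial_Kauffman_state by blast
  interpret wf_digraph ?R
    by (intro wf_digraph_reverse_arcs wf_digraph_tait_graph)
  \<comment> \<open>The class \<open>P\<close> of the lemmas on bipartite digraphs is the set of
    crossings; reversal keeps each edge between a crossing and a region.\<close>
  have bipartite: "tail ?R e \<in> range Crossing \<longleftrightarrow> head ?R e \<notin> range Crossing" for e
    by (auto simp: tail_reverse_tait_graph head_reverse_tait_graph)
  have "(\<exists>p. cycle p) \<longleftrightarrow> (\<exists>vs es. monochromatic_loop \<gamma> B vs es \<and> supports_loop x es)"
  proof
    assume "\<exists>p. cycle p"
    then obtain p where p: "cycle p" ..
    note mono = cycle_reverse_tait_graph_monochromatic[OF M p]
    have "simple_loop (tait_graph \<gamma> B) (map (tail ?R) p) p"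
      using simple_loop_if_cycle[OF bipartite p] by (simp only: simple_loop_reverse_arcs)
    moreover have "alternating ?M p"
      using alternating_if_cycle[OF bipartite p] alternating_crossing_tail_iff[OF mono] by blast
    ultimately show "\<exists>vs es. monochromatic_loop \<gamma> B vs es \<and> supports_loop x es"
      using mono monochromatic_loop_iff unfolding supports_loop_def by blast
  next
    assume "\<exists>vs es. monochromatic_loop \<gamma> B vs es \<and> supports_loop x es"
    then obtain vs es where loop: "simple_loop ?R vs es"
      and mono: "region_of ` set es \<subseteq> B \<or> region_of ` set es \<inter> B = {}"
      and alt: "alternating ?M es"
      by (auto simp: monochromatic_loop_iff supports_loop_def simple_loop_reverse_arcs)
    show "\<exists>p. cycle p"
      using ex_cycle_if_alternating_simple_loop[OF bipartite loop]
        alternating_crossing_tail_iff[OF mono] alt by blast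
  qed
  then show ?thesis
    using M by (simp add: induces_discrete_Morse_function_def discrete_Morse_function_def
        acyclic_matching_def)
qed

end
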